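(* A non-zero commutative ring $R$ is isomorphic to the neural ring of some neural code $\mathcal{C}$ if and only if there is a subset $S=\{s_1,s_2,\dots,s_r\}$ ($r\ge 1$, the $s_j$ pairwise distinct) of $R$ and a sequence $T=t_1,t_2,\dots,t_n$ ($n\ge 1$) of elements of $R$ such that the following conditions hold: (N1) Every element $x\in R$ can be uniquely written as a sum $x=s_{j_1}+s_{j_2}+\dots+s_{j_p}$ ($p\ge 0$) of distinct elements of $S$ (uniqueness up to the order of summands; the empty sum is $0$). (N2) For any $t_i$ from $T$ and any $s_j\in S$, $t_is_j\in\{0,s_j\}$. (N3) For any two distinct elements $s_j,s_k\in S$ there is at least one element $t_i$ from $T$ such that exactly one of the elements $t_is_j$, $t_is_k$ is equal to $0$. Moreover, given a non-zero commutative ring $R$ with the properties (N1), (N2), (N3) satisfied by its subset $S=\{s_1,\dots,s_r\}$ and a sequence $T=t_1,\dots,t_n$ of its elements, the code $\mathcal{C}$ and the ring isomorphism $\phi:R\to(\mathcal{P}(\mathcal{C}),\triangle,\cap)$ can be selected in such a way that the elements of $S$ correspond to the words of $\mathcal{C}$ (as singletons) and the elements of $T$ to the simple trunks of $\mathcal{C}$; that is, $\mathcal{C}=\{\mathbf{w}^1,\dots,\mathbf{w}^r\}\subseteq\mathbb{F}_2^n$ with $\mathbf{w}^1,\dots,\mathbf{w}^r$ distinct, $\phi(s_j)=\{\mathbf{w}^j\}$ for all $j\in\{1,\dots,r\}$, and $\phi(t_i)=\mathrm{Tk}_i^{\mathcal{C}}$ for all $i\in\{1,\dots,n\}$.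
   Context: Rings have an identity element. A neural code (code) of length $n\ge 0$ is a subset $\mathcal{C}\subseteq\mathbb{F}_2^n$; its elements $\mathbf{w}=w_1w_2\dots w_n$ are called words ($\mathbb{F}_2^0$ consists of the empty word only). The neural ring of $\mathcal{C}$ is the ring $(\mathcal{P}(\mathcal{C}),\triangle,\cap)$, where $\mathcal{P}(\mathcal{C})$ is the power set of $\mathcal{C}$, addition is symmetric difference $\triangle$ and multiplication is intersection $\cap$ (zero element $\emptyset$, identity element $\mathcal{C}$); it is isomorphic to $\mathbb{F}_2[X_1,\dots,X_n]/\mathcal{I}(\mathcal{C})$, where $\mathcal{I}(\mathcal{C})$ is the ideal of polynomials vanishing on $\mathcal{C}$. For $i\in\{1,\dots,n\}$, the simple trunk of $\mathcal{C}$ determined by $i$ is $\mathrm{Tk}_i^{\mathcal{C}}=\{\mathbf{w}=w_1\dots w_n\in\mathcal{C} : w_i=1\}$. *)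

theory Defs
  imports "HOL-Algebra.QuotRing" "HOL-Library.Z2" "HOL-Library.FuncSet"
begin

text \<open>A word \<open>w\<^sub>1 \<dots> w\<^sub>n\<close> over the field \<^typ>\<open>bit\<close> with two elements is an extensional function on
  \<open>{1..n}\<close>; for \<open>n = 0\<close> there is exactly one, the empty word.\<close>

type_synonym word = "nat \<Rightarrow> bit"

definition neural_code :: "nat \<Rightarrow> word set \<Rightarrow> bool" where
  "neural_code n C \<longleftrightarrow> C \<subseteq> {1..n} \<rightarrow>\<^sub>E (UNIV :: bit set)"

definition simple_trunk :: "word set \<Rightarrow> nat \<Rightarrow> word set" where
  "simple_trunk C i = {w \<in> C. w i = 1}"

definition neural_ring :: "word set \<Rightarrow> word set ring" where
  "neural_ring C =
    \<lparr>carrier = Pow C, mult = (\<inter>), one = C, zero = {}, add = sym_diff\<rparr>"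

lemma cring_neural_ring: "cring (neural_ring C)"
proof (rule cringI)
  show "abelian_group (neural_ring C)"
    by (rule abelian_groupI) (auto simp: neural_ring_def)
  show "comm_monoid (neural_ring C)"
    by (rule comm_monoidI) (auto simp: neural_ring_def)
qed (auto simp: neural_ring_def)

text \<open>The set \<open>S = {s\<^sub>1, \<dots>, s\<^sub>r}\<close> is given by an enumeration \<open>s\<close>, injective on \<open>{1..r}\<close>, and the
  sequence \<open>T = t\<^sub>1, \<dots>, t\<^sub>n\<close> by a function \<open>t\<close> on \<open>{1..n}\<close>, not necessarily injective. A sum of
  distinct elements of \<open>S\<close>, up to the order of summands, is a sum over a subset of \<open>S\<close>.\<close>

definition N1 :: "('a, 'm) ring_scheme \<Rightarrow> nat \<Rightarrow> (nat \<Rightarrow> 'a) \<Rightarrow> bool" where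
  "N1 R r s \<longleftrightarrow>
    (\<forall>x\<in>carrier R. \<exists>!A. A \<subseteq> s ` {1..r} \<and> x = (\<Oplus>\<^bsub>R\<^esub>a\<in>A. a))"

definition N2 :: "('a, 'm) ring_scheme \<Rightarrow> nat \<Rightarrow> (nat \<Rightarrow> 'a) \<Rightarrow> nat \<Rightarrow> (nat \<Rightarrow> 'a) \<Rightarrow> bool" where
  "N2 R r s n t \<longleftrightarrow>
    (\<forall>i\<in>{1..n}. \<forall>j\<in>{1..r}. t i \<otimes>\<^bsub>R\<^esub> s j \<in> {\<zero>\<^bsub>R\<^esub>, s j})"

definition N3 :: "('a, 'm) ring_scheme \<Rightarrow> nat \<Rightarrow> (nat \<Rightarrow> 'a) \<Rightarrow> nat \<Rightarrow> (nat \<Rightarrow> 'a) \<Rightarrow> bool" where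
  "N3 R r s n t \<longleftrightarrow>
    (\<forall>j\<in>{1..r}. \<forall>k\<in>{1..r}. s j \<noteq> s k \<longrightarrow>
      (\<exists>i\<in>{1..n}. (t i \<otimes>\<^bsub>R\<^esub> s j = \<zero>\<^bsub>R\<^esub>) \<noteq> (t i \<otimes>\<^bsub>R\<^esub> s k = \<zero>\<^bsub>R\<^esub>)))"

end

theory Submission
  imports Defs
begin

text \<open>By (N2) and (N3), distinct elements of \<open>S\<close> are separated by some \<open>t\<^sub>i\<close> that kills one and fixes
  the other, so their product is zero. Multiplying the expansion of \<open>1\<close> from (N1) by \<open>s\<^sub>k \<noteq> 0\<close> then
  shows that \<open>s\<^sub>k\<close> occurs in it and is idempotent. Hence \<open>S\<close> is a complete system of orthogonal
  idempotents, every element of \<open>R\<close> is idempotent, \<open>R\<close> has characteristic two, and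
  \<open>x \<mapsto> {w\<^sup>j | x s\<^sub>j \<noteq> 0}\<close> is the isomorphism, where \<open>w\<^sup>j\<close> has \<open>i\<close>-th letter \<open>1\<close> iff \<open>t\<^sub>i s\<^sub>j \<noteq> 0\<close>.\<close>

section \<open>Orthogonal idempotents from (N1), (N2), (N3)\<close>

locale neural_basis = cring R for R (structure) +
  fixes r :: nat and s :: "nat \<Rightarrow> 'a" and n :: nat and t :: "nat \<Rightarrow> 'a"
  assumes s_carrier: "s ` {1..r} \<subseteq> carrier R"
    and s_inj: "inj_on s {1..r}"
    and t_carrier: "t ` {1..n} \<subseteq> carrier R"
    and N1: "N1 R r s" and N2: "N2 R r s n t" and N3: "N3 R r s n t"
begin

lemma s_closed [simp]: "j \<in> {1..r} \<Longrightarrow> s j \<in> carrier R"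
  using s_carrier by blast

lemma t_closed [simp]: "i \<in> {1..n} \<Longrightarrow> t i \<in> carrier R"
  using t_carrier by blast

lemma s_eq_iff: "j \<in> {1..r} \<Longrightarrow> k \<in> {1..r} \<Longrightarrow> s j = s k \<longleftrightarrow> j = k"
  using s_inj by (auto dest: inj_onD)

text \<open>Injectivity of \<open>s\<close> turns the set of summands in (N1) into a set of
  indices.\<close>

lemma expansion:
  assumes "x \<in> carrier R"
  obtains J where "J \<subseteq> {1..r}" "x = (\<Oplus>j\<in>J. s j)"
proof -
  obtain A where A: "A \<subseteq> s ` {1..r}" "x = (\<Oplus>a\<in>A. a)"
    using N1 assms unfolding N1_def by blast
  then obtain J where J: "J \<subseteq> {1..r}" "A = s ` J"
    by (auto simp: subset_image_iff)
  have "x = (\<Oplus>j\<in>J. s j)"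
    using finsum_reindex[of "\<lambda>a. a" s J] A J s_carrier inj_on_subset[OF s_inj] by blast
  with J that show thesis by blast
qed

text \<open>Otherwise \<open>{}\<close> and \<open>{\<zero>}\<close> would be two expansions of
  zero, against uniqueness in (N1).\<close>

lemma s_nonzero:
  assumes "j \<in> {1..r}"
  shows "s j \<noteq> \<zero>"
proof
  assume *: "s j = \<zero>"
  have "\<exists>!A. A \<subseteq> s ` {1..r} \<and> \<zero> = (\<Oplus>a\<in>A. a)"
    using N1 unfolding N1_def by blast
  moreover have "{} \<subseteq> s ` {1..r} \<and> \<zero> = (\<Oplus>a\<in>{}. a)"
    by simp
  moreover have "{\<zero>} \<subseteq> s ` {1..r} \<and> \<zero> = (\<Oplus>a\<in>{\<zero>}. a)"
    using assms * by (auto simp: image_iff intro!: bexI[of _ j])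
  ultimately have "{} = {\<zero>}" by (metis (no_types, lifting))
  then show False by blast
qed

lemma s_orthogonal:
  assumes "j \<in> {1..r}" "k \<in> {1..r}" "j \<noteq> k"
  shows "s j \<otimes> s k = \<zero>"
proof -
  \<comment> \<open>(N3) does not tell which of the two products with \<open>t i\<close> vanishes,
    so the indices stay arbitrary here and both orders are used below.\<close>
  have separated: "s j \<otimes> s k = \<zero>"
    if "i \<in> {1..n}" "j \<in> {1..r}" "k \<in> {1..r}" "t i \<otimes> s j = \<zero>" "t i \<otimes> s k \<noteq> \<zero>" for i j k
  proof -
    have "t i \<otimes> s k = s k" using N2 that unfolding N2_def by blast
    then have "s j \<otimes> s k = s j \<otimes> (t i \<otimes> s k)" by simp
    also have "\<dots> = (t i \<otimes> s j) \<otimes> s k"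
      using that(1-3) by (simp add: m_ac)
    finally show ?thesis using that by simp
  qed
  obtain i where "i \<in> {1..n}" "(t i \<otimes> s j = \<zero>) \<noteq> (t i \<otimes> s k = \<zero>)"
    using N3 assms s_eq_iff unfolding N3_def by metis
  with separated[of i j k] separated[of i k j] assms show ?thesis
    by (metis m_comm s_closed)
qed

text \<open>Orthogonality kills every term but the \<open>k\<close>-th. The square remains because
  idempotence is itself deduced from this formula.\<close>

lemma finsum_s_mult:
  assumes "J \<subseteq> {1..r}" "k \<in> {1..r}"
  shows "(\<Oplus>j\<in>J. s j) \<otimes> s k = (if k \<in> J then s k \<otimes> s k else \<zero>)"
proof -
  have fin: "finite J" using assms finite_subset by blast
  have J: "s \<in> J \<rightarrow> carrier R" using assms by auto
  have "(\<Oplus>j\<in>J. s j) \<otimes> s k = (\<Oplus>j\<in>J. s j \<otimes> s k)"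
    using finsum_ldistr[OF fin _ J] assms by simp
  also have "\<dots> = (\<Oplus>j\<in>J. if k = j then s j \<otimes> s j else \<zero>)"
    using assms J s_orthogonal by (intro finsum_cong') auto
  also have "\<dots> = (if k \<in> J then s k \<otimes> s k else \<zero>)"
  proof (cases "k \<in> J")
    case True
    then show ?thesis
      using finsum_singleton[of k J "\<lambda>j. s j \<otimes> s j"] fin J by auto
  next
    case False
    then have "(\<Oplus>j\<in>J. if k = j then s j \<otimes> s j else \<zero>) = (\<Oplus>j\<in>J. \<zero>)"
      by (intro finsum_cong') auto
    with False show ?thesis by simp
  qed
  finally show ?thesis .
qed

lemma one_expansion: "\<one> = (\<Oplus>j\<in>{1..r}. s j)"
  and s_idem: "k \<in> {1..r} \<Longrightarrow> s k \<otimes> s k = s k"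
proof -
  obtain J where J: "J \<subseteq> {1..r}" "\<one> = (\<Oplus>j\<in>J. s j)"
    using expansion by blast
  \<comment> \<open>With \<open>\<one>\<close> as the sum, \<open>s k\<close> is either its own
    square or zero, and it is not zero.\<close>
  have *: "k \<in> J \<and> s k \<otimes> s k = s k" if "k \<in> {1..r}" for k
    using finsum_s_mult[OF J(1) that] s_nonzero[OF that] that
    unfolding J(2)[symmetric] by (auto split: if_splits)
  then have "J = {1..r}" using J(1) by blast
  then show "\<one> = (\<Oplus>j\<in>{1..r}. s j)" using J by simp
  show "k \<in> {1..r} \<Longrightarrow> s k \<otimes> s k = s k" using * by blast
qed

lemma finsum_s_mult':
  assumes "J \<subseteq> {1..r}" "k \<in> {1..r}"
  shows "(\<Oplus>j\<in>J. s j) \<otimes> s k = (if k \<in> J then s k else \<zero>)"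
  using finsum_s_mult[OF assms] s_idem assms by simp

text \<open>Expanding \<open>x\<close> extends the dichotomy of (N2) from the \<open>t i\<close> to
  the whole ring.\<close>

lemma mult_s:
  assumes "x \<in> carrier R" "k \<in> {1..r}"
  shows "x \<otimes> s k = s k \<or> x \<otimes> s k = \<zero>"
  using expansion[OF assms(1)] finsum_s_mult' assms(2) by metis

section \<open>Coordinates of ring elements as subsets of \<open>{1..r}\<close>\<close>

definition support :: "'a \<Rightarrow> nat set" where
  "support x = {j \<in> {1..r}. x \<otimes> s j \<noteq> \<zero>}"

lemma support_subset: "support x \<subseteq> {1..r}"
  by (auto simp: support_def)

text \<open>Multiplication by \<open>s j\<close> tests whether \<open>j\<close> is in
  \<open>J\<close>, so a sum determines its index set.\<close>

lemma support_finsum: "J \<subseteq> {1..r} \<Longrightarrow> support (\<Oplus>j\<in>J. s j) = J"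
  using s_nonzero by (auto simp: support_def finsum_s_mult' subset_iff split: if_splits)

lemma bij_betw_support: "bij_betw support (carrier R) (Pow {1..r})"
proof (rule bij_betw_byWitness[where f' = "\<lambda>J. \<Oplus>j\<in>J. s j"])
  show "\<forall>x\<in>carrier R. (\<Oplus>j\<in>support x. s j) = x"
    using expansion support_finsum by metis
  show "\<forall>J\<in>Pow {1..r}. support (\<Oplus>j\<in>J. s j) = J"
    by (simp add: support_finsum)
  show "support ` carrier R \<subseteq> Pow {1..r}"
    using support_subset by blast
  show "(\<lambda>J. \<Oplus>j\<in>J. s j) ` Pow {1..r} \<subseteq> carrier R"
    using s_carrier by (auto intro!: finsum_closed)
qed

lemma support_s: "j \<in> {1..r} \<Longrightarrow> support (s j) = {j}"
  using support_finsum[of "{j}"] by simp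

lemma support_one: "support \<one> = {1..r}"
  using support_finsum[of "{1..r}"] one_expansion by simp

text \<open>As \<open>y \<otimes> s j\<close> is zero or \<open>s j\<close>, multiplying it by
  \<open>x\<close> gives zero or \<open>x \<otimes> s j\<close>.\<close>

lemma support_mult:
  assumes "x \<in> carrier R" "y \<in> carrier R"
  shows "support (x \<otimes> y) = support x \<inter> support y"
proof -
  have "x \<otimes> y \<otimes> s j \<noteq> \<zero> \<longleftrightarrow> x \<otimes> s j \<noteq> \<zero> \<and> y \<otimes> s j \<noteq> \<zero>" if "j \<in> {1..r}" for j
  proof -
    have "x \<otimes> y \<otimes> s j = x \<otimes> (y \<otimes> s j)"
      using assms that by (simp add: m_assoc)
    then show ?thesis
      using mult_s[OF assms(2) that] assms s_nonzero[OF that] by auto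
  qed
  then show ?thesis by (auto simp: support_def)
qed

lemma char_two: "\<one> \<oplus> \<one> = \<zero>"
proof -
  \<comment> \<open>\<open>x \<otimes> x\<close> and \<open>x\<close> have the same support, and
    \<open>support\<close> is injective.\<close>
  have idem: "x \<otimes> x = x" if "x \<in> carrier R" for x
    using that support_mult[OF that that] bij_betw_imp_inj_on[OF bij_betw_support]
    by (auto dest: inj_onD)
  \<comment> \<open>The square of \<open>\<one> \<oplus> \<one>\<close> expands to four ones, which
    idempotence equates with two; then cancel.\<close>
  have "(\<one> \<oplus> \<one>) \<oplus> (\<one> \<oplus> \<one>) = (\<one> \<oplus> \<one>) \<oplus> \<zero>"
    using idem[of "\<one> \<oplus> \<one>"] by (simp add: l_distr r_distr)
  then show ?thesis by (metis a_closed one_closed r_zero zero_closed add.m_assoc r_neg a_inv_closed)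
qed

text \<open>Both products with \<open>s j\<close> lie in \<open>{\<zero>, s j}\<close>, so by
  characteristic two their sum vanishes exactly when they agree.\<close>

lemma support_add:
  assumes "x \<in> carrier R" "y \<in> carrier R"
  shows "support (x \<oplus> y) = sym_diff (support x) (support y)"
proof -
  have "(x \<oplus> y) \<otimes> s j = \<zero> \<longleftrightarrow> (x \<otimes> s j = \<zero> \<longleftrightarrow> y \<otimes> s j = \<zero>)" if "j \<in> {1..r}" for j
  proof -
    have "s j \<oplus> s j = (\<one> \<oplus> \<one>) \<otimes> s j"
      using that by (simp add: l_distr)
    then have "s j \<oplus> s j = \<zero>" using that by (simp add: char_two)
    moreover have "(x \<oplus> y) \<otimes> s j = x \<otimes> s j \<oplus> y \<otimes> s j"
      using assms that by (simp add: l_distr)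
    ultimately show ?thesis
      using mult_s[OF assms(1) that] mult_s[OF assms(2) that] s_nonzero[OF that] that by auto
  qed
  then show ?thesis by (auto simp: support_def)
qed

text \<open>The bounded lambda makes the word extensional on \<open>{1..n}\<close>, as
  \<open>neural_code\<close> demands.\<close>

definition codeword :: "nat \<Rightarrow> word" where
  "codeword j = (\<lambda>i\<in>{1..n}. if t i \<otimes> s j = \<zero> then 0 else 1)"

text \<open>(N3) provides a letter at which the two words differ.\<close>

lemma inj_on_codeword: "inj_on codeword {1..r}"
proof (rule inj_onI, rule ccontr)
  fix j k assume jk: "j \<in> {1..r}" "k \<in> {1..r}" "codeword j = codeword k" "j \<noteq> k"
  then obtain i where "i \<in> {1..n}" "(t i \<otimes> s j = \<zero>) \<noteq> (t i \<otimes> s k = \<zero>)"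
    using N3 s_eq_iff unfolding N3_def by metis
  with fun_cong[OF jk(3), of i] show False
    by (auto simp: codeword_def split: if_splits)
qed

lemma neural_code_codeword: "neural_code n (codeword ` {1..r})"
  by (auto simp: neural_code_def codeword_def)

text \<open>Coordinates are relabelled by words; injectivity of \<open>codeword\<close> makes its
  image commute with intersections and differences.\<close>

lemma codeword_support_iso:
  "(\<lambda>x. codeword ` support x) \<in> ring_iso R (neural_ring (codeword ` {1..r}))"
proof -
  have "bij_betw (image codeword) (Pow {1..r}) (Pow (codeword ` {1..r}))"
    by (intro bij_betw_Pow inj_on_imp_bij_betw inj_on_codeword)
  from bij_betw_trans[OF bij_betw_support this]
  have "bij_betw (\<lambda>x. codeword ` support x) (carrier R) (Pow (codeword ` {1..r}))"
    by (simp add: comp_def)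
  moreover have "codeword ` (support x \<inter> support y) = codeword ` support x \<inter> codeword ` support y"
    and "codeword ` sym_diff (support x) (support y) =
      sym_diff (codeword ` support x) (codeword ` support y)" for x y
    using inj_on_image_Int[OF inj_on_codeword, of "support x" "support y"]
      inj_on_image_set_diff[OF inj_on_codeword, of "support x" "support y"]
      inj_on_image_set_diff[OF inj_on_codeword, of "support y" "support x"]
      support_subset[of x] support_subset[of y]
    by (simp_all add: image_Un Diff_subset[THEN subset_trans])
  moreover have "codeword ` support x \<subseteq> codeword ` {1..r}" for x
    using support_subset by (rule image_mono)
  ultimately show ?thesis
    by (intro ring_iso_memI)
      (simp_all add: neural_ring_def support_mult support_add support_one)
qed

text \<open>The \<open>i\<close>-th letter of \<open>codeword j\<close> tests
  \<open>t i \<otimes> s j\<close>, so both sides collect the same words.\<close>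

lemma codeword_support_t:
  assumes "i \<in> {1..n}"
  shows "codeword ` support (t i) = simple_trunk (codeword ` {1..r}) i"
  using assms by (auto simp: support_def simple_trunk_def codeword_def)

end

section \<open>From a neural ring to (N1), (N2), (N3)\<close>

locale neural_ring_iso = cring R for R (structure) +
  fixes m :: nat and C :: "word set" and g :: "word set \<Rightarrow> 'a"
  assumes code: "neural_code m C"
    and iso: "g \<in> ring_iso (neural_ring C) R"
begin

lemma finite_C: "finite C"
proof -
  have "finite (UNIV :: bit set)"
    by (rule finite_subset[of _ "{0, 1}"]) auto
  then show ?thesis
    using code finite_PiE[of "{1..m}" "\<lambda>_. UNIV :: bit set"]
    by (auto simp: neural_code_def intro: finite_subset)
qed

lemma g_bij: "bij_betw g (Pow C) (carrier R)"
  and g_closed [simp]: "A \<subseteq> C \<Longrightarrow> g A \<in> carrier R"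
  and g_Int: "A \<subseteq> C \<Longrightarrow> B \<subseteq> C \<Longrightarrow> g (A \<inter> B) = g A \<otimes> g B"
  and g_sym_diff: "A \<subseteq> C \<Longrightarrow> B \<subseteq> C \<Longrightarrow> g (sym_diff A B) = g A \<oplus> g B"
  using ring_iso_memE[OF iso] by (auto simp: neural_ring_def)

lemma g_eq_iff: "A \<subseteq> C \<Longrightarrow> B \<subseteq> C \<Longrightarrow> g A = g B \<longleftrightarrow> A = B"
  using bij_betw_imp_inj_on[OF g_bij] by (auto dest: inj_onD)

text \<open>The empty set is its own symmetric difference with itself, so \<open>g {}\<close> equals
  its double; cancel.\<close>

lemma g_empty [simp]: "g {} = \<zero>"
  using g_sym_diff[of "{}" "{}"] by (metis Diff_empty Un_empty add.l_cancel_one' empty_subsetI g_closed)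

lemma g_eq_zero_iff: "A \<subseteq> C \<Longrightarrow> g A = \<zero> \<longleftrightarrow> A = {}"
  using g_eq_iff[of A "{}"] by simp

lemma finsum_g_singletons:
  assumes "A \<subseteq> C"
  shows "(\<Oplus>v\<in>A. g {v}) = g A"
  using finite_subset[OF assms finite_C] assms
proof (induction A)
  case (insert v A)
  \<comment> \<open>As \<open>v\<close> is not in \<open>A\<close>, inserting it is a symmetric
    difference with \<open>{v}\<close>.\<close>
  then have "g (insert v A) = g {v} \<oplus> g A"
    using g_sym_diff[of "{v}" A] by (simp add: insert_Diff_if Un_commute)
  with insert show ?case by (subst finsum_insert) auto
qed simp

text \<open>This is (N1) for the images of singletons. Summing them over \<open>B\<close> gives
  \<open>g B\<close>, so existence is surjectivity of \<open>g\<close> and uniqueness its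
  injectivity.\<close>

lemma unique_expansion:
  assumes "x \<in> carrier R"
  shows "\<exists>!A. A \<subseteq> (\<lambda>v. g {v}) ` C \<and> x = (\<Oplus>a\<in>A. a)"
proof -
  have inj: "inj_on (\<lambda>v. g {v}) C"
    by (auto simp: inj_on_def g_eq_iff)
  have sum: "(\<Oplus>a\<in>(\<lambda>v. g {v}) ` B. a) = g B" if "B \<subseteq> C" for B
    using finsum_reindex[of "\<lambda>a. a" "\<lambda>v. g {v}" B] that inj_on_subset[OF inj that]
    by (auto simp: finsum_g_singletons Pi_iff subset_iff)
  obtain B where B: "B \<subseteq> C" "x = g B"
    using assms bij_betw_imp_surj_on[OF g_bij] by blast
  show ?thesis
  proof (rule ex1I[of _ "(\<lambda>v. g {v}) ` B"])
    fix A assume A: "A \<subseteq> (\<lambda>v. g {v}) ` C \<and> x = (\<Oplus>a\<in>A. a)"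
    then obtain B' where B': "B' \<subseteq> C" "A = (\<lambda>v. g {v}) ` B'"
      by (auto simp: subset_image_iff)
    with A B sum[of B'] g_eq_iff[of B B'] show "A = (\<lambda>v. g {v}) ` B" by auto
  qed (use B sum in auto)
qed

text \<open>A trunk meets \<open>{v}\<close> in \<open>{v}\<close> or in nothing; this yields (N2)
  and, through the vanishing criterion, (N3).\<close>

lemma trunk_mult:
  assumes "v \<in> C"
  shows "g (simple_trunk C i) \<otimes> g {v} = (if v i = 1 then g {v} else \<zero>)"
proof -
  have "g (simple_trunk C i) \<otimes> g {v} = g (simple_trunk C i \<inter> {v})"
    using assms by (subst g_Int) (auto simp: simple_trunk_def)
  also have "simple_trunk C i \<inter> {v} = (if v i = 1 then {v} else {})"
    using assms by (auto simp: simple_trunk_def)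
  finally show ?thesis by simp
qed

lemma trunk_mult_eq_zero_iff: "v \<in> C \<Longrightarrow> g (simple_trunk C i) \<otimes> g {v} = \<zero> \<longleftrightarrow> v i = 0"
  by (cases "v i") (auto simp: trunk_mult g_eq_zero_iff)

lemma ex_neural_basis:
  assumes "carrier R \<noteq> {\<zero>}"
  shows "\<exists>r s n t. r \<ge> 1 \<and> n \<ge> 1 \<and> neural_basis R r s n t"
proof -
  obtain w where w: "bij_betw w {1..card C} C"
    using ex_bij_betw_nat_finite_1[OF finite_C] by blast
  \<comment> \<open>An empty code would leave \<open>g {} = \<zero>\<close> as the only element of
    \<open>R\<close>.\<close>
  have "C \<noteq> {}"
    using assms bij_betw_imp_surj_on[OF g_bij] by auto
  then have "card C \<ge> 1"
    using finite_C by (simp add: Suc_le_eq card_gt_0_iff)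
  define s where "s = (\<lambda>j. g {w j})"
  have wC: "w j \<in> C" if "j \<in> {1..card C}" for j
    using w that by (auto simp: bij_betw_def)
  have "s ` {1..card C} = (\<lambda>v. g {v}) ` w ` {1..card C}"
    by (simp add: s_def image_image)
  then have image_s: "s ` {1..card C} = (\<lambda>v. g {v}) ` C"
    by (simp only: bij_betw_imp_surj_on[OF w])
  \<comment> \<open>The extra index \<open>m + 1\<close> makes the sequence non-empty also when \<open>m = 0\<close>.\<close>
  have "neural_basis R (card C) s (Suc m) (\<lambda>i. g (simple_trunk C i))"
  proof unfold_locales
    show "s ` {1..card C} \<subseteq> carrier R"
      unfolding image_s by auto
    show "inj_on s {1..card C}"
    proof (rule inj_onI)
      fix j k assume jk: "j \<in> {1..card C}" "k \<in> {1..card C}" "s j = s k"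
      then have "w j = w k"
        using g_eq_iff[of "{w j}" "{w k}"] wC by (simp add: s_def)
      then show "j = k"
        using jk(1,2) bij_betw_imp_inj_on[OF w] by (blast dest: inj_onD)
    qed
    show "(\<lambda>i. g (simple_trunk C i)) ` {1..Suc m} \<subseteq> carrier R"
      by (auto simp: simple_trunk_def)
    show "N1 R (card C) s"
      unfolding N1_def image_s using unique_expansion by blast
    \<comment> \<open>At \<open>Suc m\<close> all words share the default letter of extensional
      functions; \<open>trunk_mult\<close> holds at every index, so this one is covered.\<close>
    show "N2 R (card C) s (Suc m) (\<lambda>i. g (simple_trunk C i))"
      unfolding N2_def s_def using wC by (simp add: trunk_mult)
    show "N3 R (card C) s (Suc m) (\<lambda>i. g (simple_trunk C i))"
      unfolding N3_def
    proof (intro ballI impI)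
      fix j k assume jk: "j \<in> {1..card C}" "k \<in> {1..card C}" "s j \<noteq> s k"
      then have "w j \<noteq> w k" by (auto simp: s_def)
      moreover have "w j \<in> {1..m} \<rightarrow>\<^sub>E UNIV" "w k \<in> {1..m} \<rightarrow>\<^sub>E UNIV"
        using code wC[OF jk(1)] wC[OF jk(2)] by (auto simp: neural_code_def)
      \<comment> \<open>Words are extensional, so distinct ones differ inside
        \<open>{1..m}\<close>.\<close>
      ultimately obtain i where i: "i \<in> {1..m}" "w j i \<noteq> w k i"
        using PiE_ext by metis
      then have "(w j i = 0) \<noteq> (w k i = 0)"
        using bit_not_zero_iff by metis
      with i jk wC show "\<exists>i\<in>{1..Suc m}. (g (simple_trunk C i) \<otimes> s j = \<zero>)
          \<noteq> (g (simple_trunk C i) \<otimes> s k = \<zero>)"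
        by (intro bexI[of _ i]) (simp_all add: s_def trunk_mult_eq_zero_iff)
    qed
  qed
  moreover have "Suc m \<ge> 1" by simp
  ultimately show ?thesis using \<open>card C \<ge> 1\<close> by blast
qed

end

section \<open>The equivalence and the realization by words and trunks\<close>

theorem theorem2p2:
  fixes R :: "('a, 'm) ring_scheme"
  assumes "cring R" and "carrier R \<noteq> {\<zero>\<^bsub>R\<^esub>}"
  shows "((\<exists>m C. neural_code m C \<and> R \<simeq> neural_ring C) \<longleftrightarrow>
          (\<exists>r s n t. r \<ge> 1 \<and> n \<ge> 1 \<and>
             s ` {1..r} \<subseteq> carrier R \<and> inj_on s {1..r} \<and> t ` {1..n} \<subseteq> carrier R \<and>
             N1 R r s \<and> N2 R r s n t \<and> N3 R r s n t))
       \<and> (\<forall>r s n t. r \<ge> 1 \<and> n \<ge> 1 \<and>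
             s ` {1..r} \<subseteq> carrier R \<and> inj_on s {1..r} \<and> t ` {1..n} \<subseteq> carrier R \<and>
             N1 R r s \<and> N2 R r s n t \<and> N3 R r s n t \<longrightarrow>
            (\<exists>C \<phi> w. neural_code n C \<and> \<phi> \<in> ring_iso R (neural_ring C) \<and>
               C = w ` {1..r} \<and> inj_on w {1..r} \<and>
               (\<forall>j\<in>{1..r}. \<phi> (s j) = {w j}) \<and>
               (\<forall>i\<in>{1..n}. \<phi> (t i) = simple_trunk C i)))"
proof -
  have basis: "neural_basis R r s n t \<longleftrightarrow>
      s ` {1..r} \<subseteq> carrier R \<and> inj_on s {1..r} \<and> t ` {1..n} \<subseteq> carrier R \<and>
      N1 R r s \<and> N2 R r s n t \<and> N3 R r s n t" for r s n t
    unfolding neural_basis_def neural_basis_axioms_def using assms(1) by simp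
  \<comment> \<open>This serves both the explicit correspondence and the backward direction of the
    equivalence.\<close>
  have realization: "\<exists>C \<phi> w. neural_code n C \<and> \<phi> \<in> ring_iso R (neural_ring C) \<and>
      C = w ` {1..r} \<and> inj_on w {1..r} \<and>
      (\<forall>j\<in>{1..r}. \<phi> (s j) = {w j}) \<and> (\<forall>i\<in>{1..n}. \<phi> (t i) = simple_trunk C i)"
    if "neural_basis R r s n t" for r s n t
  proof -
    interpret neural_basis R r s n t by (fact that)
    show ?thesis
    \<comment> \<open>The witnesses stay schematic; unification makes \<open>w\<close> the map
      \<open>codeword\<close>, and \<phi> the support followed by the image under
      \<open>codeword\<close>.\<close>
    proof (intro exI conjI ballI)
      show "codeword ` support (s j) = {codeword j}" if "j \<in> {1..r}" for j
        using support_s[OF that] by simp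
    qed (fact neural_code_codeword codeword_support_iso inj_on_codeword codeword_support_t refl)+
  qed
  have "\<exists>r s n t. r \<ge> 1 \<and> n \<ge> 1 \<and> neural_basis R r s n t"
    if code: "neural_code m C" and "R \<simeq> neural_ring C" for m C
  proof -
    \<comment> \<open>The isomorphism is reversed so that singletons and trunks can be carried into
      \<open>R\<close>.\<close>
    have "neural_ring C \<simeq> R"
      using ring_iso_sym[OF cring.axioms(1)[OF assms(1)]] that by blast
    then obtain g where "g \<in> ring_iso (neural_ring C) R"
      by (auto simp: is_ring_iso_def)
    then interpret neural_ring_iso R m C g
      using assms(1) code by (simp add: neural_ring_iso_def neural_ring_iso_axioms_def)
    show ?thesis by (rule ex_neural_basis[OF assms(2)])
  qed
  moreover have "\<exists>m C. neural_code m C \<and> R \<simeq> neural_ring C"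
    if "neural_basis R r s n t" for r s n t
    using realization[OF that] unfolding is_ring_iso_def by blast
  ultimately have "(\<exists>m C. neural_code m C \<and> R \<simeq> neural_ring C) \<longleftrightarrow>
      (\<exists>r s n t. r \<ge> 1 \<and> n \<ge> 1 \<and> neural_basis R r s n t)"
    by meson
  then show ?thesis
    unfolding basis using realization[unfolded basis] by simp
qed

end
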